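(* Let $\mathcal{G}=(G,\pi,x)$ be a slice-domain over $\mathbb{H}$ with distinguished point. Then for each $q\in G$, there exists a finite-part path $\gamma$ in $G$ from $x$ to $q$.
   Context: $\mathbb{H}$ is the skew field of quaternions, $\mathbb{S}=\{q\in\mathbb{H}:q^2=-1\}$, and for $I\in\mathbb{S}$, $\mathbb{C}_I=\{x+yI:x,y\in\mathbb{R}\}$ with the Euclidean topology. The slice-topology $\tau_s$ on $\mathbb{H}$ is the quotient topology induced by the natural map $\bigsqcup_{I\in\mathbb{S}}\mathbb{C}_I\to\mathbb{H}$; thus $U$ is slice-open iff $U\cap\mathbb{C}_I$ is open in $\mathbb{C}_I$ for each $I\in\mathbb{S}$. A slice-domain over $\mathbb{H}$ is a pair $(G,\pi)$ with $G$ a connected Hausdorff space and $\pi:G\to\mathbb{H}$ a local homeomorphism with respect to the topology of $G$ and $\tau_s$; with a chosen point $x\in G$, $(G,\pi,x)$ is a slice-domain over $\mathbb{H}$ with distinguished point. $G_{\mathbb{R}}:=\{q\in G:\pi(q)\in\mathbb{R}\}$. A path is a continuous map from $[0,1]$. A path $\alpha$ in $G$ is slice preserving if there is $I\in\mathbb{S}$ with $\pi(\alpha([0,1]))\subset\mathbb{C}_I$. For $N\in\mathbb{N}^+$, an $N$-part path in $G$ is a tuple $\gamma=(\gamma_1,\dots,\gamma_N)$ of slice preserving paths in $G$ with $\gamma_\imath(1)=\gamma_{\imath+1}(0)\in G_{\mathbb{R}}$ for $\imath=1,\dots,N-1$; it is said to be from $\gamma_1(0)$ to $\gamma_N(1)$.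 A finite-part path in $G$ is an $N$-part path in $G$ for some $N\in\mathbb{N}^+$. *)

theory Defs
  imports "HOL-Analysis.Analysis"
begin

section \<open>The skew field of quaternions\<close>

codatatype quat = Quat (qre: real) (qim1: real) (qim2: real) (qim3: real)

lemma quat_eqI [intro?]:
  "qre p = qre q \<Longrightarrow> qim1 p = qim1 q \<Longrightarrow> qim2 p = qim2 q \<Longrightarrow> qim3 p = qim3 q \<Longrightarrow> p = q"
  by (rule quat.expand) simp

lemma quat_eq_iff:
  "p = q \<longleftrightarrow> qre p = qre q \<and> qim1 p = qim1 q \<and> qim2 p = qim2 q \<and> qim3 p = qim3 q"
  by (auto intro: quat.expand)

instantiation quat :: ab_group_add
begin

primcorec zero_quat where
  "qre 0 = 0" | "qim1 0 = 0" | "qim2 0 = 0" | "qim3 0 = 0"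

primcorec plus_quat where
  "qre (p + q) = qre p + qre q"
| "qim1 (p + q) = qim1 p + qim1 q"
| "qim2 (p + q) = qim2 p + qim2 q"
| "qim3 (p + q) = qim3 p + qim3 q"

primcorec uminus_quat where
  "qre (- p) = - qre p"
| "qim1 (- p) = - qim1 p"
| "qim2 (- p) = - qim2 p"
| "qim3 (- p) = - qim3 p"

primcorec minus_quat where
  "qre (p - q) = qre p - qre q"
| "qim1 (p - q) = qim1 p - qim1 q"
| "qim2 (p - q) = qim2 p - qim2 q"
| "qim3 (p - q) = qim3 p - qim3 q"

instance
  by standard (simp_all add: quat_eq_iff)

end

instantiation quat :: division_ring
begin

primcorec one_quat where
  "qre 1 = 1" | "qim1 1 = 0" | "qim2 1 = 0" | "qim3 1 = 0"

primcorec times_quat where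
  "qre (p * q) = qre p * qre q - qim1 p * qim1 q - qim2 p * qim2 q - qim3 p * qim3 q"
| "qim1 (p * q) = qre p * qim1 q + qim1 p * qre q + qim2 p * qim3 q - qim3 p * qim2 q"
| "qim2 (p * q) = qre p * qim2 q - qim1 p * qim3 q + qim2 p * qre q + qim3 p * qim1 q"
| "qim3 (p * q) = qre p * qim3 q + qim1 p * qim2 q - qim2 p * qim1 q + qim3 p * qre q"

primcorec inverse_quat where
  "qre (inverse q) = qre q / ((qre q)\<^sup>2 + (qim1 q)\<^sup>2 + (qim2 q)\<^sup>2 + (qim3 q)\<^sup>2)"
| "qim1 (inverse q) = - qim1 q / ((qre q)\<^sup>2 + (qim1 q)\<^sup>2 + (qim2 q)\<^sup>2 + (qim3 q)\<^sup>2)"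
| "qim2 (inverse q) = - qim2 q / ((qre q)\<^sup>2 + (qim1 q)\<^sup>2 + (qim2 q)\<^sup>2 + (qim3 q)\<^sup>2)"
| "qim3 (inverse q) = - qim3 q / ((qre q)\<^sup>2 + (qim1 q)\<^sup>2 + (qim2 q)\<^sup>2 + (qim3 q)\<^sup>2)"

definition "p div q = p * inverse q" for p q :: quat

lemma quat_normsq_nonzero:
  "(qre q)\<^sup>2 + (qim1 q)\<^sup>2 + (qim2 q)\<^sup>2 + (qim3 q)\<^sup>2 \<noteq> 0" if "q \<noteq> 0"
proof -
  have "qre q \<noteq> 0 \<or> qim1 q \<noteq> 0 \<or> qim2 q \<noteq> 0 \<or> qim3 q \<noteq> 0"
    using that by (auto simp: quat_eq_iff)
  then show ?thesis
    by (smt (verit) zero_le_power2 zero_less_power2)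
qed

instance
proof
  fix a b c :: quat
  show "a * b * c = a * (b * c)" "(a + b) * c = a * c + b * c" "a * (b + c) = a * b + a * c"
    by (simp_all add: quat_eq_iff algebra_simps)
  show "1 * a = a" "a * 1 = a" "(0::quat) \<noteq> 1" "inverse (0::quat) = 0"
    by (simp_all add: quat_eq_iff)
  show "a div b = a * inverse b"
    by (simp add: divide_quat_def)
  assume "a \<noteq> 0"
  from quat_normsq_nonzero[OF this]
  show "inverse a * a = 1" "a * inverse a = 1"
    by (simp_all add: quat_eq_iff power2_eq_square mult.commute
        flip: add_divide_distrib diff_divide_distrib)
qed

end

instantiation quat :: real_div_algebra
begin

primcorec scaleR_quat where
  "qre (scaleR r q) = r * qre q"
| "qim1 (scaleR r q) = r * qim1 q"
| "qim2 (scaleR r q) = r * qim2 q"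
| "qim3 (scaleR r q) = r * qim3 q"

instance
proof
  fix a b :: real and p q :: quat
  show "scaleR a (p + q) = scaleR a p + scaleR a q" "scaleR (a + b) p = scaleR a p + scaleR b p"
    by (simp_all add: quat_eq_iff distrib_left distrib_right)
  show "scaleR a (scaleR b p) = scaleR (a * b) p" "scaleR 1 p = p"
    by (simp_all add: quat_eq_iff)
  show "scaleR a p * q = scaleR a (p * q)" "p * scaleR a q = scaleR a (p * q)"
    by (simp_all add: quat_eq_iff algebra_simps)
qed

end

text \<open>The Euclidean structure of four-dimensional real space.\<close>

instantiation quat :: real_inner
begin

definition inner_quat :: "quat \<Rightarrow> quat \<Rightarrow> real" where
  "inner_quat p q = qre p * qre q + qim1 p * qim1 q + qim2 p * qim2 q + qim3 p * qim3 q"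

definition norm_quat :: "quat \<Rightarrow> real" where
  "norm_quat q = sqrt (inner q q)"

definition sgn_quat :: "quat \<Rightarrow> quat" where
  "sgn_quat q = q /\<^sub>R norm q"

definition dist_quat :: "quat \<Rightarrow> quat \<Rightarrow> real" where
  "dist_quat p q = norm (p - q)"

definition uniformity_quat :: "(quat \<times> quat) filter" where
  "uniformity_quat = (INF e\<in>{0 <..}. principal {(x, y). dist x y < e})"

definition open_quat :: "quat set \<Rightarrow> bool" where
  "open_quat U \<longleftrightarrow> (\<forall>x\<in>U. eventually (\<lambda>(x', y). x' = x \<longrightarrow> y \<in> U) uniformity)"

instance
proof
  fix p q s :: quat and r :: real
  show "inner p q = inner q p"
    by (simp add: inner_quat_def mult.commute)
  show "inner (p + q) s = inner p s + inner q s" "inner (scaleR r p) q = r * inner p q"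
    by (simp_all add: inner_quat_def algebra_simps)
  show "0 \<le> inner p p"
    by (simp add: inner_quat_def)
  show "inner p p = 0 \<longleftrightarrow> p = 0"
    using quat_normsq_nonzero[of p] by (auto simp: inner_quat_def power2_eq_square)
qed (simp_all add: norm_quat_def sgn_quat_def dist_quat_def uniformity_quat_def open_quat_def)

end

instance quat :: real_normed_div_algebra
proof
  fix p q :: quat
  show "norm (p * q) = norm p * norm q"
    unfolding norm_quat_def real_sqrt_mult[symmetric] inner_quat_def
    by (rule arg_cong[where f = sqrt], simp only: times_quat.sel, algebra)
qed

instantiation quat :: euclidean_space
begin

definition Basis_quat :: "quat set" where
  "Basis_quat = {Quat 1 0 0 0, Quat 0 1 0 0, Quat 0 0 1 0, Quat 0 0 0 1}"

instance
proof
  show "(Basis :: quat set) \<noteq> {}" "finite (Basis :: quat set)"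
    by (simp_all add: Basis_quat_def)
  show "inner u v = (if u = v then 1 else 0)" if "u \<in> Basis" "v \<in> Basis" for u v :: quat
    using that unfolding Basis_quat_def inner_quat_def
    by (elim insertE emptyE) simp_all
  show "(\<forall>u\<in>Basis. inner q u = 0) \<longleftrightarrow> q = 0" for q :: quat
    by (simp add: Basis_quat_def inner_quat_def) (auto simp: quat_eq_iff)
qed

end


section \<open>The slice topology\<close>

definition imag_units :: "quat set" where
  "imag_units = {q. q\<^sup>2 = - 1}"

definition slice_plane :: "quat \<Rightarrow> quat set" where
  "slice_plane I = {of_real x + of_real y * I | x y. True}"

text \<open>
  The quotient (final) topology for the natural map from the disjoint union of the slices;
  a point of the disjoint union is a pair \<open>(I, q)\<close> with \<open>q \<in> slice_plane I\<close>.
\<close>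

definition slice_sum :: "(quat \<times> quat) topology" where
  "slice_sum = sum_topology (\<lambda>I. top_of_set (slice_plane I)) imag_units"

definition slice_topology :: "quat topology" where
  "slice_topology = topology (\<lambda>U. openin slice_sum {p \<in> topspace slice_sum. snd p \<in> U})"

lemma openin_slice_topology:
  "openin slice_topology U \<longleftrightarrow>
    (\<forall>I\<in>imag_units. openin (top_of_set (slice_plane I)) (U \<inter> slice_plane I))"
proof -
  let ?P = "\<lambda>U. openin slice_sum {p \<in> topspace slice_sum. snd p \<in> U}"
  have "istopology ?P"
    unfolding istopology_def
  proof (intro conjI allI impI)
    fix S T assume "?P S" "?P T"
    then have "openin slice_sum ({p \<in> topspace slice_sum. snd p \<in> S} \<inter> {p \<in> topspace slice_sum. snd p \<in> T})"
      by (rule openin_Int)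
    then show "?P (S \<inter> T)"
      by (rule back_subst[where P = "openin slice_sum"]) auto
  next
    fix K assume "\<forall>S\<in>K. ?P S"
    then have "openin slice_sum (\<Union>S\<in>K. {p \<in> topspace slice_sum. snd p \<in> S})"
      by (intro openin_Union) auto
    then show "?P (\<Union>K)"
      by (rule back_subst[where P = "openin slice_sum"]) auto
  qed
  then have "openin slice_topology U \<longleftrightarrow> ?P U"
    by (simp add: slice_topology_def)
  also have "{p \<in> topspace slice_sum. snd p \<in> U} = Sigma imag_units (\<lambda>I. U \<inter> slice_plane I)"
    by (auto simp: slice_sum_def)
  finally show ?thesis
    by (simp add: slice_sum_def openin_disjoint_union)
qed

lemma topspace_slice_topology [simp]: "topspace slice_topology = UNIV"
proof -
  have "openin slice_topology UNIV"
    by (simp add: openin_slice_topology)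
  then show ?thesis
    using openin_subset by blast
qed

lemma slice_planes_cover: "(\<Union>I\<in>imag_units. slice_plane I) = UNIV"
proof -
  have "\<exists>I\<in>imag_units. q \<in> slice_plane I" for q
  proof -
    define v where "v = q - of_real (qre q)"
    have sel [simp]: "qre (of_real r) = r" "qim1 (of_real r) = 0" "qim2 (of_real r) = 0" "qim3 (of_real r) = 0" for r
      by (simp_all add: of_real_def)
    have v [simp]: "qre v = 0" "qim1 v = qim1 q" "qim2 v = qim2 q" "qim3 v = qim3 q"
      by (simp_all add: v_def)
    have v2: "v * v = - ((norm v)\<^sup>2 *\<^sub>R 1)"
      by (simp add: quat_eq_iff norm_quat_def inner_quat_def)
    show ?thesis
    proof (cases "v = 0")
      case True
      have "Quat 0 1 0 0 \<in> imag_units"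
        by (simp add: imag_units_def power2_eq_square quat_eq_iff)
      moreover have "q = of_real (qre q) + of_real 0 * Quat 0 1 0 0"
        using True by (simp add: v_def)
      ultimately show ?thesis
        unfolding slice_plane_def by blast
    next
      case False
      have "inverse (norm v) * (inverse (norm v) * (norm v * norm v)) = 1"
        using False by (simp flip: mult.assoc)
      then have "(v /\<^sub>R norm v)\<^sup>2 = - 1"
        by (simp add: power2_eq_square v2)
      then have "v /\<^sub>R norm v \<in> imag_units"
        by (simp add: imag_units_def)
      moreover have "q = of_real (qre q) + of_real (norm v) * (v /\<^sub>R norm v)"
      proof -
        have "of_real (norm v) * (v /\<^sub>R norm v) = v"
          using False by (simp add: of_real_def)
        then show ?thesis
          by (simp add: v_def)
      qed
      ultimately show ?thesis
        unfolding slice_plane_def by blast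
    qed
  qed
  then show ?thesis by blast
qed

lemma quotient_map_slice_topology: "quotient_map slice_sum slice_topology snd"
proof -
  have "{p \<in> topspace slice_sum. snd p \<in> U} = Sigma imag_units (\<lambda>I. U \<inter> slice_plane I)" for U
    by (auto simp: slice_sum_def)
  moreover have "snd ` topspace slice_sum = UNIV"
    using slice_planes_cover by (simp add: slice_sum_def snd_image_Sigma)
  ultimately show ?thesis
    unfolding quotient_map_def
    by (simp add: openin_slice_topology) (simp add: slice_sum_def openin_disjoint_union)
qed


section \<open>Slice-domains and finite-part paths\<close>

definition local_homeomorphism_map ::
    "'a topology \<Rightarrow> 'b topology \<Rightarrow> ('a \<Rightarrow> 'b) \<Rightarrow> bool" where
  "local_homeomorphism_map X Y f \<longleftrightarrow>
    (\<forall>x\<in>topspace X. \<exists>U. openin X U \<and> x \<in> U \<and> openin Y (f ` U) \<and>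
       homeomorphic_map (subtopology X U) (subtopology Y (f ` U)) f)"

definition slice_domain :: "'a topology \<Rightarrow> ('a \<Rightarrow> quat) \<Rightarrow> bool" where
  "slice_domain G \<pi> \<longleftrightarrow>
    connected_space G \<and> Hausdorff_space G \<and> local_homeomorphism_map G slice_topology \<pi>"

definition slice_domain_pointed :: "'a topology \<Rightarrow> ('a \<Rightarrow> quat) \<Rightarrow> 'a \<Rightarrow> bool" where
  "slice_domain_pointed G \<pi> x \<longleftrightarrow> slice_domain G \<pi> \<and> x \<in> topspace G"

definition real_points :: "'a topology \<Rightarrow> ('a \<Rightarrow> quat) \<Rightarrow> 'a set" where
  "real_points G \<pi> = {q \<in> topspace G. \<pi> q \<in> \<real>}"

definition slice_preserving :: "('a \<Rightarrow> quat) \<Rightarrow> (real \<Rightarrow> 'a) \<Rightarrow> bool" where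
  "slice_preserving \<pi> \<alpha> \<longleftrightarrow> (\<exists>I\<in>imag_units. \<pi> ` \<alpha> ` {0..1} \<subseteq> slice_plane I)"

text \<open>An \<open>N\<close>-part path is a list of length \<open>N\<close>; its components are numbered from \<open>0\<close>.\<close>

definition part_path ::
    "nat \<Rightarrow> 'a topology \<Rightarrow> ('a \<Rightarrow> quat) \<Rightarrow> (real \<Rightarrow> 'a) list \<Rightarrow> bool" where
  "part_path N G \<pi> \<gamma> \<longleftrightarrow>
    N > 0 \<and> length \<gamma> = N \<and>
    (\<forall>\<alpha>\<in>set \<gamma>. pathin G \<alpha> \<and> slice_preserving \<pi> \<alpha>) \<and>
    (\<forall>i. Suc i < N \<longrightarrow> (\<gamma> ! i) 1 = (\<gamma> ! Suc i) 0 \<and> (\<gamma> ! i) 1 \<in> real_points G \<pi>)"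

definition finite_part_path ::
    "'a topology \<Rightarrow> ('a \<Rightarrow> quat) \<Rightarrow> (real \<Rightarrow> 'a) list \<Rightarrow> bool" where
  "finite_part_path G \<pi> \<gamma> \<longleftrightarrow> (\<exists>N>0. part_path N G \<pi> \<gamma>)"

definition path_from_to :: "(real \<Rightarrow> 'a) list \<Rightarrow> 'a \<Rightarrow> 'a \<Rightarrow> bool" where
  "path_from_to \<gamma> a b \<longleftrightarrow> (hd \<gamma>) 0 = a \<and> (last \<gamma>) 1 = b"

end

theory Submission
  imports Defs
begin

text \<open>
  Around a point of \<open>G\<close> the projection identifies a neighbourhood with a slice-open set; the
  points of it that are visible from the centre along a segment inside a single slice form a smaller
  neighbourhood, all of whose points are joined to the centre by slice preserving paths.
  Appending a slice preserving path to a finite-part path is always possible: at a real point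
  it becomes a new part, and at a non-real point, which lies in only one slice, it is
  concatenated with the last part. So the set of points reachable from \<open>x\<close> and its complement
  are both open, and connectedness finishes the proof.
\<close>

section \<open>Imaginary units and slices\<close>

lemma qre_imag_unit:
  assumes "I \<in> imag_units"
  shows "qre I = 0"
proof (rule ccontr)
  assume nz: "qre I \<noteq> 0"
  have "I * I = - 1"
    using assms by (simp add: imag_units_def power2_eq_square)
  then have "qre I * qre I - qim1 I * qim1 I - qim2 I * qim2 I - qim3 I * qim3 I = - 1"
    "2 * qre I * qim1 I = 0" "2 * qre I * qim2 I = 0" "2 * qre I * qim3 I = 0"
    by (auto simp: quat_eq_iff)
  \<comment> \<open>Were \<open>qre I\<close> nonzero, the last three equations would make the
    imaginary components vanish, leaving a negative real square.\<close>
  then have "qre I * qre I = - 1"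
    using nz by simp
  then show False
    using zero_le_square[of "qre I"] by linarith
qed

text \<open>Imaginary units have real part 0, so comparing real parts leaves
  \<open>y *\<^sub>R I = y' *\<^sub>R J\<close>. Since \<open>p\<close> is not real,
  \<open>y'\<close> is nonzero, and \<open>J\<close> is a real multiple of \<open>I\<close>.\<close>

lemma slice_plane_subsetI:
  assumes "I \<in> imag_units" "J \<in> imag_units"
    and "p \<in> slice_plane I" "p \<in> slice_plane J" "p \<notin> \<real>"
  shows "slice_plane J \<subseteq> slice_plane I"
proof -
  obtain x y x' y' where p: "p = of_real x + of_real y * I" "p = of_real x' + of_real y' * J"
    using assms(3,4) unfolding slice_plane_def by blast
  have "qre p = x"
    by (subst p(1)) (simp add: of_real_def qre_imag_unit[OF assms(1)])
  moreover have "qre p = x'"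
    by (subst p(2)) (simp add: of_real_def qre_imag_unit[OF assms(2)])
  ultimately have eq: "y *\<^sub>R I = y' *\<^sub>R J"
    using p by (simp add: scaleR_conv_of_real)
  have "y' \<noteq> 0"
    using p(2) \<open>p \<notin> \<real>\<close> by auto
  then have J: "J = (y / y') *\<^sub>R I"
    using arg_cong[OF eq, of "scaleR (inverse y')"] by (simp add: divide_inverse mult.commute)
  show ?thesis
  proof
    fix z assume "z \<in> slice_plane J"
    then obtain a b where "z = of_real a + of_real b * J"
      by (auto simp: slice_plane_def)
    then have "z = of_real a + of_real (b * (y / y')) * I"
      using J by (metis scaleR_conv_of_real scaleR_scaleR)
    then show "z \<in> slice_plane I"
      unfolding slice_plane_def by blast
  qed
qed

lemma slice_plane_unique:
  assumes "I \<in> imag_units" "J \<in> imag_units"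
    and "p \<in> slice_plane I" "p \<in> slice_plane J" "p \<notin> \<real>"
  shows "slice_plane I = slice_plane J"
  using slice_plane_subsetI assms by (metis subset_antisym)

lemma Reals_subset_slice_plane: "\<real> \<subseteq> slice_plane I"
proof
  fix p :: quat assume "p \<in> \<real>"
  then obtain r where "p = of_real r + of_real 0 * I"
    by (auto elim: Reals_cases)
  then show "p \<in> slice_plane I"
    unfolding slice_plane_def by blast
qed

lemma subspace_slice_plane: "subspace (slice_plane I)"
proof -
  have "slice_plane I = (\<lambda>(x, y). of_real x + of_real y * I) ` UNIV"
    by (auto simp: slice_plane_def)
  moreover have "linear (\<lambda>(x, y). of_real x + of_real y * I)"
    by (rule linearI) (auto simp: scaleR_conv_of_real algebra_simps)
  ultimately show ?thesis
    using linear_subspace_image subspace_UNIV by metis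
qed

lemma convex_slice_plane: "convex (slice_plane I)"
  by (rule subspace_imp_convex[OF subspace_slice_plane])

section \<open>Slice-open sets and segments\<close>

lemma openin_slice_topology_minus_Reals: "openin slice_topology (- \<real>)"
proof -
  have "closed (\<real> :: quat set)"
    by (rule closed_subspace) (auto simp: subspace_def scaleR_conv_of_real)
  \<comment> \<open>A Euclidean open set is slice-open, because its trace on each slice is
    relatively open.\<close>
  then show ?thesis
    unfolding openin_slice_topology
    by (metis Int_commute openin_open_Int open_Compl)
qed

lemma continuous_map_slice_plane_slice_topology:
  assumes "I \<in> imag_units"
  shows "continuous_map (top_of_set (slice_plane I)) slice_topology id"
  using assms by (auto simp: continuous_map_def openin_slice_topology Int_def conj_commute)

text \<open>By compactness, \<open>S\<close> contains a whole \<open>e\<close>-neighbourhood of the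
  segment. Moving the endpoint by less than \<open>e\<close> moves the point at each parameter by no
  more than that.\<close>

lemma open_segment_core:
  fixes r :: "'a::real_normed_vector"
  assumes "open S"
  shows "open {p. closed_segment r p \<subseteq> S}"
  unfolding open_dist
proof
  fix p assume "p \<in> {p. closed_segment r p \<subseteq> S}"
  then obtain e where e: "e > 0" "(\<Union>x\<in>closed_segment r p. ball x e) \<subseteq> S"
    using compact_subset_open_imp_ball_epsilon_subset[of "closed_segment r p" S] assms by auto
  have "closed_segment r p' \<subseteq> S" if d: "dist p' p < e" for p'
  proof
    fix z assume "z \<in> closed_segment r p'"
    then obtain u where u: "0 \<le> u" "u \<le> 1" and z: "z = (1 - u) *\<^sub>R r + u *\<^sub>R p'"
      by (auto simp: in_segment)
    define y where "y = (1 - u) *\<^sub>R r + u *\<^sub>R p"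
    have "dist y z = norm (u *\<^sub>R (p - p'))"
      by (simp add: y_def z dist_norm algebra_simps)
    also have "\<dots> = u * dist p' p"
      using u by (simp add: dist_norm norm_minus_commute)
    also have "\<dots> \<le> dist p' p"
      using u by (simp add: mult_left_le_one_le)
    finally have "z \<in> ball y e"
      using d by simp
    moreover have "y \<in> closed_segment r p"
      using u by (auto simp: in_segment y_def)
    ultimately show "z \<in> S"
      using e by blast
  qed
  with e show "\<exists>e>0. \<forall>y. dist y p < e \<longrightarrow> y \<in> {p. closed_segment r p \<subseteq> S}"
    by blast
qed

text \<open>Euclidean balls will not do here: the size of a slice-open set around a real point may
  shrink to 0 as the slice varies. The part visible from \<open>r\<close> only has to be checked for
  openness one slice at a time.\<close>

lemma slice_open_segment_neighbourhood:
  assumes V: "openin slice_topology V" and r: "r \<in> V"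
  obtains S where "openin slice_topology S" "r \<in> S" "S \<subseteq> V"
    "\<And>p. p \<in> S \<Longrightarrow> \<exists>I\<in>imag_units. closed_segment r p \<subseteq> V \<inter> slice_plane I"
proof -
  \<comment> \<open>For a non-real centre the real points must go: they are the only points that can be seen
    from \<open>r\<close> although they also lie in slices not containing \<open>r\<close>.\<close>
  define V' where "V' = (if r \<in> \<real> then V else V \<inter> - \<real>)"
  have V': "openin slice_topology V'" "r \<in> V'" "V' \<subseteq> V"
    using V r openin_slice_topology_minus_Reals by (auto simp: V'_def)
  define S where "S = {p. \<exists>I\<in>imag_units. closed_segment r p \<subseteq> V' \<inter> slice_plane I}"
  have "openin (top_of_set (slice_plane J)) (S \<inter> slice_plane J)" if J: "J \<in> imag_units" for J
  proof (cases "r \<in> slice_plane J")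
    case True
    obtain B where B: "open B" "V' \<inter> slice_plane J = slice_plane J \<inter> B"
      using V'(1) J unfolding openin_slice_topology openin_open by blast
    \<comment> \<open>Convexity puts the segment inside \<open>J\<close>, so on this slice
      membership in \<open>S\<close> does not depend on the \<open>I\<close> chosen as
      witness.\<close>
    have sub: "closed_segment r p \<subseteq> slice_plane J" if "p \<in> slice_plane J" for p
      using True that convex_slice_plane closed_segment_subset by blast
    have "S \<inter> slice_plane J = slice_plane J \<inter> {p. closed_segment r p \<subseteq> B}"
    proof (intro equalityI subsetI)
      fix p assume p: "p \<in> S \<inter> slice_plane J"
      then have "closed_segment r p \<subseteq> V' \<inter> slice_plane J"
        using sub by (auto simp: S_def)
      then show "p \<in> slice_plane J \<inter> {p. closed_segment r p \<subseteq> B}"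
        using B p by auto
    next
      fix p assume p: "p \<in> slice_plane J \<inter> {p. closed_segment r p \<subseteq> B}"
      then have "closed_segment r p \<subseteq> V' \<inter> slice_plane J"
        using sub B by blast
      then show "p \<in> S \<inter> slice_plane J"
        using p J by (auto simp: S_def)
    qed
    then show ?thesis
      using open_segment_core[OF B(1)] by (metis openin_open_Int)
  next
    case False
    \<comment> \<open>Here \<open>r\<close> is not real, so \<open>V'\<close> has no real points. A
      \<open>p\<close> in both \<open>I\<close> and \<open>J\<close> would make the two slices equal
      and put \<open>r\<close> in \<open>J\<close>.\<close>
    have "p \<notin> slice_plane J" if "p \<in> S" for p
    proof
      assume pJ: "p \<in> slice_plane J"
      obtain I where I: "I \<in> imag_units" "closed_segment r p \<subseteq> V' \<inter> slice_plane I"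
        using \<open>p \<in> S\<close> unfolding S_def by blast
      then have "r \<in> slice_plane I" "p \<in> slice_plane I" "p \<in> V'"
        by auto
      moreover have "r \<notin> \<real>"
        using False Reals_subset_slice_plane by blast
      ultimately show False
        using slice_plane_unique[OF I(1) J, of p] pJ False by (auto simp: V'_def)
    qed
    then have "S \<inter> slice_plane J = {}"
      by blast
    then show ?thesis
      by simp
  qed
  then have "openin slice_topology S"
    by (simp add: openin_slice_topology)
  moreover have "r \<in> S"
    using slice_planes_cover V'(2) by (auto simp: S_def)
  moreover have "S \<subseteq> V"
    using V'(3) by (auto simp: S_def)
  moreover have "\<exists>I\<in>imag_units. closed_segment r p \<subseteq> V \<inter> slice_plane I" if "p \<in> S" for p
    using that V'(3) by (auto simp: S_def)
  ultimately show thesis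
    by (rule that)
qed

section \<open>Paths within one slice and their lifts\<close>

lemma pathin_linepath_slice_topology:
  assumes "I \<in> imag_units" "closed_segment a b \<subseteq> slice_plane I"
  shows "pathin slice_topology (linepath a b)"
proof -
  have "pathin (top_of_set (slice_plane I)) (linepath a b)"
    using assms(2) by (force simp: pathin_canon_iff linepath_in_path)
  from pathin_compose[OF this continuous_map_slice_plane_slice_topology[OF assms(1)]]
  show ?thesis
    by simp
qed

text \<open>Phrased through path components so that reversal and concatenation of paths come as
  symmetry and transitivity for fixed \<open>I\<close>.\<close>

definition slice_joined :: "'a topology \<Rightarrow> ('a \<Rightarrow> quat) \<Rightarrow> quat \<Rightarrow> 'a \<Rightarrow> 'a \<Rightarrow> bool" where
  "slice_joined G \<pi> I = path_component_of (subtopology G (\<pi> -` slice_plane I))"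

lemma slice_joined_iff:
  "slice_joined G \<pi> I a b \<longleftrightarrow>
    (\<exists>\<alpha>. pathin G \<alpha> \<and> \<pi> ` \<alpha> ` {0..1} \<subseteq> slice_plane I \<and> \<alpha> 0 = a \<and> \<alpha> 1 = b)"
  by (auto simp: slice_joined_def path_component_of_def pathin_subtopology image_subset_iff)

lemma slice_joined_mem:
  assumes "slice_joined G \<pi> I a b"
  shows "\<pi> a \<in> slice_plane I" "\<pi> b \<in> slice_plane I"
  using path_component_in_topspace[OF assms[unfolded slice_joined_def]] by auto

text \<open>Segments from \<pi> \<open>q\<close> inside a slice lift to \<open>G\<close> through the
  local inverse \<open>g\<close>, and \<pi> sends each lift back to its segment, so the lift stays
  over that slice.\<close>

lemma slice_joined_neighbourhood:
  assumes "local_homeomorphism_map G slice_topology \<pi>" and q: "q \<in> topspace G"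
  obtains W where "openin G W" "q \<in> W"
    "\<And>w. w \<in> W \<Longrightarrow> \<exists>I\<in>imag_units. slice_joined G \<pi> I q w"
proof -
  obtain U where U: "openin G U" "q \<in> U" "openin slice_topology (\<pi> ` U)"
    and hom: "homeomorphic_map (subtopology G U) (subtopology slice_topology (\<pi> ` U)) \<pi>"
    using assms unfolding local_homeomorphism_map_def by blast
  obtain g where g: "homeomorphic_maps (subtopology G U) (subtopology slice_topology (\<pi> ` U)) \<pi> g"
    using hom homeomorphic_map_maps by blast
  have UG: "U \<subseteq> topspace G"
    using U(1) by (rule openin_subset)
  have g\<pi>: "g (\<pi> y) = y" if "y \<in> U" for y
    using g UG that by (auto simp: homeomorphic_maps_def)
  have contg: "continuous_map (subtopology slice_topology (\<pi> ` U)) G g"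
    and cont\<pi>: "continuous_map (subtopology G U) slice_topology \<pi>"
    using g by (auto simp: homeomorphic_maps_def continuous_map_in_subtopology)
  obtain S where S: "openin slice_topology S" "\<pi> q \<in> S" "S \<subseteq> \<pi> ` U"
    and seg: "\<And>p. p \<in> S \<Longrightarrow> \<exists>I\<in>imag_units. closed_segment (\<pi> q) p \<subseteq> \<pi> ` U \<inter> slice_plane I"
    using slice_open_segment_neighbourhood[OF U(3)] U(2) by blast
  define W where "W = {y \<in> U. \<pi> y \<in> S}"
  have "openin (subtopology G U) W"
    using openin_continuous_map_preimage[OF cont\<pi> S(1)] UG
    by (simp add: W_def Int_absorb1 Int_absorb2)
  then have "openin G W"
    using U(1) openin_trans_full by blast
  moreover have "q \<in> W"
    using U S by (simp add: W_def)
  moreover have "\<exists>I\<in>imag_units. slice_joined G \<pi> I q w" if "w \<in> W" for w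
  proof -
    have w: "w \<in> U" "\<pi> w \<in> S"
      using that by (auto simp: W_def)
    obtain I where I: "I \<in> imag_units" "closed_segment (\<pi> q) (\<pi> w) \<subseteq> \<pi> ` U \<inter> slice_plane I"
      using seg[OF w(2)] by blast
    let ?l = "linepath (\<pi> q) (\<pi> w)"
    have l: "?l t \<in> \<pi> ` U" "?l t \<in> slice_plane I" if "t \<in> {0..1}" for t
      using I(2) linepath_in_path[OF that] by blast+
    have "pathin (subtopology slice_topology (\<pi> ` U)) ?l"
      using pathin_linepath_slice_topology[OF I(1)] I(2) l by (auto simp: pathin_subtopology)
    from pathin_compose[OF this contg] have "pathin G (g \<circ> ?l)" .
    moreover have "\<pi> ` (g \<circ> ?l) ` {0..1} \<subseteq> slice_plane I"
    proof clarsimp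
      fix t :: real assume "0 \<le> t" "t \<le> 1"
      then have t: "t \<in> {0..1}" by simp
      obtain y where "y \<in> U" "?l t = \<pi> y"
        using l(1)[OF t] by blast
      then show "\<pi> (g (?l t)) \<in> slice_plane I"
        using l(2)[OF t] by (simp add: g\<pi>)
    qed
    moreover have "(g \<circ> ?l) 0 = q" "(g \<circ> ?l) 1 = w"
      using g\<pi> U(2) w(1) by (simp_all add: linepath_0' linepath_1')
    ultimately show ?thesis
      using I(1) unfolding slice_joined_iff by blast
  qed
  ultimately show thesis
    by (rule that)
qed

section \<open>Finite-part paths and their extension\<close>

lemma finite_part_path_singleton:
  "finite_part_path G \<pi> [\<alpha>] \<longleftrightarrow> pathin G \<alpha> \<and> slice_preserving \<pi> \<alpha>"
  by (auto simp: finite_part_path_def part_path_def)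

lemma finite_part_path_snoc:
  assumes "\<gamma> \<noteq> []"
  shows "finite_part_path G \<pi> (\<gamma> @ [\<alpha>]) \<longleftrightarrow>
    finite_part_path G \<pi> \<gamma> \<and> pathin G \<alpha> \<and> slice_preserving \<pi> \<alpha> \<and>
    last \<gamma> 1 = \<alpha> 0 \<and> last \<gamma> 1 \<in> real_points G \<pi>"
proof -
  obtain m where m: "length \<gamma> = Suc m"
    using assms by (cases \<gamma>) auto
  then have "last \<gamma> = \<gamma> ! m"
    using assms by (simp add: last_conv_nth)
  \<comment> \<open>The extended list has junctions \<open>0\<close> to \<open>m\<close>; the one
    numbered \<open>m\<close> is new and the others belong to \<gamma>.\<close>
  moreover have "(\<forall>i<Suc m. P i) \<longleftrightarrow> (\<forall>i<m. P i) \<and> P m" for P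
    by (auto simp: less_Suc_eq)
  ultimately show ?thesis
    using m by (auto simp: finite_part_path_def part_path_def nth_append)
qed

lemma finite_part_path_extend:
  assumes \<gamma>: "finite_part_path G \<pi> \<gamma>" "path_from_to \<gamma> x w"
    and I: "I \<in> imag_units" and wv: "slice_joined G \<pi> I w v"
  obtains \<gamma>' where "finite_part_path G \<pi> \<gamma>'" "path_from_to \<gamma>' x v"
proof (cases "\<pi> w \<in> \<real>")
  case True
  obtain \<beta> where \<beta>: "pathin G \<beta>" "\<pi> ` \<beta> ` {0..1} \<subseteq> slice_plane I" "\<beta> 0 = w" "\<beta> 1 = v"
    using wv by (auto simp: slice_joined_iff)
  have "\<gamma> \<noteq> []"
    using \<gamma>(1) by (auto simp: finite_part_path_def part_path_def)
  moreover have "w \<in> real_points G \<pi>"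
    using True \<beta>(1,3) path_start_in_topspace by (auto simp: real_points_def)
  moreover have "slice_preserving \<pi> \<beta>"
    using \<beta>(2) I by (auto simp: slice_preserving_def)
  ultimately have "finite_part_path G \<pi> (\<gamma> @ [\<beta>])" "path_from_to (\<gamma> @ [\<beta>]) x v"
    using \<gamma> \<beta> by (auto simp: finite_part_path_snoc path_from_to_def)
  then show thesis
    by (rule that)
next
  case False
  obtain \<delta> \<alpha> where \<delta>: "\<gamma> = \<delta> @ [\<alpha>]"
    using \<gamma>(1) by (cases \<gamma> rule: rev_cases) (auto simp: finite_part_path_def part_path_def)
  have \<alpha>: "pathin G \<alpha>" "slice_preserving \<pi> \<alpha>" "\<alpha> 1 = w"
    using \<gamma> by (auto simp: \<delta> finite_part_path_def part_path_def path_from_to_def)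
  obtain J where J: "J \<in> imag_units" "slice_joined G \<pi> J (\<alpha> 0) w"
    using \<alpha> unfolding slice_preserving_def slice_joined_iff by blast
  \<comment> \<open>The non-real \<pi> \<open>w\<close> lies in the slice of the last part and in
    that of the added path.\<close>
  have "slice_plane J = slice_plane I"
    using slice_plane_unique[OF J(1) I _ _ False] slice_joined_mem[OF J(2)] slice_joined_mem[OF wv]
    by blast
  then have "slice_joined G \<pi> I (\<alpha> 0) v"
    using J(2) wv unfolding slice_joined_def by (metis path_component_of_trans)
  then obtain \<beta> where \<beta>: "pathin G \<beta>" "slice_preserving \<pi> \<beta>" "\<beta> 0 = \<alpha> 0" "\<beta> 1 = v"
    using I by (auto simp: slice_joined_iff slice_preserving_def)
  \<comment> \<open>The new last part starts where \<alpha> did, so the junction with \<delta>, if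
    there is one, is unchanged.\<close>
  have "finite_part_path G \<pi> (\<delta> @ [\<beta>])"
    using \<gamma>(1) \<beta> by (cases "\<delta> = []") (auto simp: \<delta> finite_part_path_singleton finite_part_path_snoc)
  moreover have "path_from_to (\<delta> @ [\<beta>]) x v"
    using \<gamma>(2) \<beta> by (cases \<delta>) (auto simp: \<delta> path_from_to_def)
  ultimately show thesis
    by (rule that)
qed

section \<open>Reachability and connectedness\<close>

theorem theorem6p11:
  fixes G :: "'a topology" and \<pi> :: "'a \<Rightarrow> quat" and x :: 'a
  assumes "slice_domain_pointed G \<pi> x"
  shows "\<forall>q\<in>topspace G. \<exists>\<gamma>. finite_part_path G \<pi> \<gamma> \<and> path_from_to \<gamma> x q"
proof -
  have conn: "connected_space G" and loc: "local_homeomorphism_map G slice_topology \<pi>"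
    and x: "x \<in> topspace G"
    using assms by (auto simp: slice_domain_pointed_def slice_domain_def)
  let ?R = "\<lambda>q. \<exists>\<gamma>. finite_part_path G \<pi> \<gamma> \<and> path_from_to \<gamma> x q"
  define A where "A = {q \<in> topspace G. ?R q}"
  have extend: "?R v" if "?R w" "I \<in> imag_units" "slice_joined G \<pi> I w v" for I w v
    using that finite_part_path_extend by metis
  \<comment> \<open>Reachability is locally constant: symmetry of \<open>slice_joined\<close> allows
    extension from \<open>q\<close> to \<open>w\<close> and from \<open>w\<close> back to
    \<open>q\<close>.\<close>
  have nbhd: "\<exists>W. openin G W \<and> q \<in> W \<and> (\<forall>w\<in>W. ?R w \<longleftrightarrow> ?R q)" if q: "q \<in> topspace G" for q
  proof -
    obtain W where W: "openin G W" "q \<in> W"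
      "\<And>w. w \<in> W \<Longrightarrow> \<exists>I\<in>imag_units. slice_joined G \<pi> I q w"
      using slice_joined_neighbourhood[OF loc q] by blast
    have "?R w \<longleftrightarrow> ?R q" if "w \<in> W" for w
    proof -
      obtain I where "I \<in> imag_units" "slice_joined G \<pi> I q w" "slice_joined G \<pi> I w q"
        using W(3)[OF \<open>w \<in> W\<close>] by (auto simp: slice_joined_def path_component_of_sym)
      then show ?thesis
        using extend by blast
    qed
    with W show ?thesis by blast
  qed
  have "openin G A"
    unfolding openin_subopen[of G A]
  proof
    fix q assume "q \<in> A"
    then obtain W where "openin G W" "q \<in> W" "\<forall>w\<in>W. ?R w"
      using nbhd[of q] unfolding A_def by blast
    moreover from this have "W \<subseteq> A"
      using openin_subset[of G W] by (auto simp: A_def)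
    ultimately show "\<exists>T. openin G T \<and> q \<in> T \<and> T \<subseteq> A"
      by blast
  qed
  moreover have "openin G (topspace G - A)"
    unfolding openin_subopen[of G "topspace G - A"]
  proof
    fix q assume "q \<in> topspace G - A"
    then obtain W where "openin G W" "q \<in> W" "\<forall>w\<in>W. \<not> ?R w"
      using nbhd[of q] unfolding A_def by blast
    moreover from this have "W \<subseteq> topspace G - A"
      using openin_subset[of G W] by (auto simp: A_def)
    ultimately show "\<exists>T. openin G T \<and> q \<in> T \<and> T \<subseteq> topspace G - A"
      by blast
  qed
  ultimately have "A = {} \<or> A = topspace G"
    using conn unfolding connected_space_clopen_in closedin_def by (metis openin_subset)
  moreover have "x \<in> A"
  proof -
    obtain I where "I \<in> imag_units" "\<pi> x \<in> slice_plane I"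
      using slice_planes_cover by blast
    \<comment> \<open>The constant path is slice preserving because \<pi> \<open>x\<close> lies in
      some slice.\<close>
    then have "finite_part_path G \<pi> [\<lambda>_. x]"
      using x by (auto simp: finite_part_path_singleton slice_preserving_def)
    then show ?thesis
      using x by (auto simp: A_def path_from_to_def)
  qed
  ultimately show ?thesis
    by (auto simp: A_def)
qed

end
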